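(* Consider the online crowdsourcing scheduling setting described in the context. Suppose an entity knows in advance the exact times of every meeting between the requester and the crowd workers, and using this information makes optimal task scheduling decisions $\Lambda_{OPT}=\{\mathcal{S}_1^*,\dots,\mathcal{S}_m^*\}$ with total weighted completion time $WCT_{OPT}$. Let $WCT_{CosMOS}$ be the total weighted completion time of the schedule produced by the CosMOS algorithm. Then $$\frac{WCT_{CosMOS}}{WCT_{OPT}} \leq \alpha\left(1 + \frac{n\cdot w_{max}\cdot\frac{2}{\lambda_{min}}}{w_{min}\sum_{i=1}^{n}\tau_{i}}\right),$$ where $\alpha =\max\left\{\frac{3}{2},\frac{w_{max}\cdot\lambda_{max}}{w_{min}\cdot\lambda_{min}}\right\}$ in general, and $\alpha = 2-\frac{1}{m}$ if $\tau_{min} > \frac{2}{\lambda_{max}}$.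
   Context: There are a requester $u_0$, $m\ge1$ crowd workers $u_1,\dots,u_m$ with rates $\lambda_1\ge\lambda_2\ge\cdots\ge\lambda_m>0$ (inter-meeting times between $u_0$ and $u_j$ are modeled as exponential with rate $\lambda_j$, so the expected meeting time is $1/\lambda_j$), and $n$ indivisible tasks $s_1,\dots,s_n$ with required service times $\tau_i>0$ and weights $w_i>0$, indexed so that $\frac{w_1}{\tau_1}\ge\cdots\ge\frac{w_n}{\tau_n}$. A schedule assigns each task to one worker ($\mathcal{S}_j$ = tasks of $u_j$), and each worker processes its tasks sequentially. In reality, a task $s_i\in\mathcal{S}_j$ has completion time $t_j+t'_j+T_i+\tau_i$, where $t_j$ and $t'_j$ are the actual inter-meeting times between $u_0$ and $u_j$ for task distribution and feedback delivery, and $T_i$ is the total required service time of tasks processed on $u_j$ before $s_i$; the total weighted completion time is the sum of $w_i$ times these completion times. $w_{max},w_{min}$ are the max/min weights, $\lambda_{max},\lambda_{min}$ the max/min rates, $\tau_{min}=\min_i\tau_i$. CosMOS algorithm (online; the requester meets workers over time, in the order $u_1,u_2,\dots,u_m$): each time $u_0$ meets a remaining worker $u_j$, set $EW_j=\frac{1}{\lambda_j}$ and $EW_k=\frac{2}{\lambda_k}-\frac{1}{\lambda_j}$ for every other remaining worker $u_k$, with all $\mathcal{S}_k=\emptyset$; then for each remaining task $s_i$ in increasing order of $i$, put $s_i$ into $\mathcal{S}_{k_{\min}}$ with $k_{\min}=\arg\min_k EW_k$ over remaining workers and increase $EW_{k_{\min}}$ by $\tau_i$. Then $\mathcal{S}_j$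 is handed to $u_j$ and executed in LRF (increasing index) order; the tasks of $\mathcal{S}_j$ and the worker $u_j$ are removed, and the process repeats at the next meeting.
   Formalization: The bound is proved in expectation over the exponential inter-meeting times, both for the ratio of expected total weighted completion times and for the expected ratio; for individual realisations of the meeting times it fails, e.g. when the feedback meeting time of the chosen worker is very long. *)

theory Defs
  imports "HOL-Probability.Probability"
begin

(* Workers are 1..m and tasks are 1..n.  A schedule S maps each worker j to the list of the
   tasks of j in processing order. *)

type_synonym schedule = "nat \<Rightarrow> nat list"

definition valid_schedule :: "nat \<Rightarrow> nat \<Rightarrow> schedule \<Rightarrow> bool" where
  "valid_schedule m n S \<longleftrightarrow>
     (\<forall>j\<in>{1..m}. distinct (S j) \<and> set (S j) \<subseteq> {1..n}) \<and>
     (\<forall>i\<in>{1..n}. \<exists>!j. j \<in> {1..m} \<and> i \<in> set (S j))"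

(* The total required service time of the tasks processed on worker j before task i. *)
definition service_before :: "(nat \<Rightarrow> real) \<Rightarrow> schedule \<Rightarrow> nat \<Rightarrow> nat \<Rightarrow> real" where
  "service_before \<tau> S j i = (\<Sum>k \<leftarrow> takeWhile (\<lambda>k. k \<noteq> i) (S j). \<tau> k)"

(* t j and t' j are the inter-meeting times for distribution to and feedback from worker j. *)
definition completion_time ::
    "(nat \<Rightarrow> real) \<Rightarrow> (nat \<Rightarrow> real) \<Rightarrow> (nat \<Rightarrow> real) \<Rightarrow> schedule \<Rightarrow> nat \<Rightarrow> nat \<Rightarrow> real" where
  "completion_time \<tau> t t' S j i = t j + t' j + service_before \<tau> S j i + \<tau> i"

definition WCT ::
    "nat \<Rightarrow> (nat \<Rightarrow> real) \<Rightarrow> (nat \<Rightarrow> real) \<Rightarrow> (nat \<Rightarrow> real) \<Rightarrow> (nat \<Rightarrow> real) \<Rightarrow> schedule \<Rightarrow> real" where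
  "WCT m \<tau> w t t' S = (\<Sum>j = 1..m. \<Sum>i\<in>set (S j). w i * completion_time \<tau> t t' S j i)"

definition optimal_schedule ::
    "nat \<Rightarrow> nat \<Rightarrow> (nat \<Rightarrow> real) \<Rightarrow> (nat \<Rightarrow> real) \<Rightarrow> (nat \<Rightarrow> real) \<Rightarrow> (nat \<Rightarrow> real) \<Rightarrow> schedule \<Rightarrow> bool" where
  "optimal_schedule m n \<tau> w t t' S \<longleftrightarrow> is_arg_min (WCT m \<tau> w t t') (valid_schedule m n) S"

(* Initial values of EW at the meeting with worker j. *)
definition initial_EW :: "(nat \<Rightarrow> real) \<Rightarrow> nat \<Rightarrow> nat \<Rightarrow> real" where
  "initial_EW rate j k = (if k = j then 1 / rate j else 2 / rate k - 1 / rate j)"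

(* One planning pass over a list of remaining tasks, with R the set of remaining workers.
   It is a relation because ties in the argmin may be broken arbitrarily. *)
inductive greedy_plan ::
    "(nat \<Rightarrow> real) \<Rightarrow> nat set \<Rightarrow> (nat \<Rightarrow> real) \<Rightarrow> nat list \<Rightarrow> schedule \<Rightarrow> bool"
  for \<tau> :: "nat \<Rightarrow> real" and R :: "nat set" where
  no_task: "greedy_plan \<tau> R EW [] (\<lambda>_. [])"
| assign_task: "\<lbrakk>is_arg_min EW (\<lambda>k. k \<in> R) kmin;
            greedy_plan \<tau> R (EW(kmin := EW kmin + \<tau> i)) ts P\<rbrakk>
    \<Longrightarrow> greedy_plan \<tau> R EW (i # ts) (P(kmin := i # P kmin))"

(* cosmos_run rate \<tau> js ts S: with js the remaining workers in the order in which they are met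
   and ts the remaining tasks, the worker at the head of js is handed its part of a fresh plan,
   and the rest of the plan is discarded. *)
inductive cosmos_run ::
    "(nat \<Rightarrow> real) \<Rightarrow> (nat \<Rightarrow> real) \<Rightarrow> nat list \<Rightarrow> nat list \<Rightarrow> schedule \<Rightarrow> bool"
  for rate :: "nat \<Rightarrow> real" and \<tau> :: "nat \<Rightarrow> real" where
  no_worker: "cosmos_run rate \<tau> [] ts (\<lambda>_. [])"
| meet_worker: "\<lbrakk>greedy_plan \<tau> (set (j # js)) (initial_EW rate j) ts P;
             cosmos_run rate \<tau> js (filter (\<lambda>i. i \<notin> set (P j)) ts) S\<rbrakk>
    \<Longrightarrow> cosmos_run rate \<tau> (j # js) ts (S(j := P j))"

definition cosmos_schedule ::
    "nat \<Rightarrow> nat \<Rightarrow> (nat \<Rightarrow> real) \<Rightarrow> (nat \<Rightarrow> real) \<Rightarrow> schedule \<Rightarrow> bool" where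
  "cosmos_schedule m n rate \<tau> S \<longleftrightarrow> cosmos_run rate \<tau> [1..<Suc m] [1..<Suc n] S"

end

theory Submission
  imports Defs
begin

text \<open>Up to tie-breaking, each replanning step of CosMOS merely shifts all loads by a
  constant, so the final schedule is a single greedy plan with initial loads \<open>2 / rate j\<close>,
  and its cost at these loads is its expected weighted completion time. In a greedy plan every
  task starts no later than the average load. With \<open>M1\<close> the cost of serving
  all tasks by index on one worker and \<open>D = (\<Sum>i. w i * \<tau> i)\<close>, this bounds the
  expected cost by \<open>B + M1 / m + (1 - 1 / m) * D\<close>, where
  \<open>B = n * w_max * (2 / rate_min)\<close>. Conversely, by Eastman, Even and Isaacs every
  schedule costs at least \<open>M1 / m + (1 - 1 / m) / 2 * D\<close>, and trivially at least
  \<open>D\<close>, even if all meeting times vanish. Both values of \<open>\<alpha>\<close> exceed the resulting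
  factor \<open>3 / 2 - 1 / (2 * m)\<close>.\<close>

section \<open>Weighted completion time of a single list of tasks\<close>

text \<open>The start time \<open>a\<close> is kept abstract because four kinds of start are used:
  actual meeting delays, their mean \<open>2 / rate j\<close>, the value \<open>0\<close> in lower
  bounds, and an average load in the comparison with a single fast worker.\<close>

definition list_cost :: "(nat \<Rightarrow> real) \<Rightarrow> (nat \<Rightarrow> real) \<Rightarrow> real \<Rightarrow> nat list \<Rightarrow> real" where
  "list_cost \<tau> w a xs =
     (\<Sum>i\<in>set xs. w i * (a + (\<Sum>k \<leftarrow> takeWhile (\<lambda>k. k \<noteq> i) xs. \<tau> k) + \<tau> i))"

lemma list_cost_Nil [simp]: "list_cost \<tau> w a [] = 0"
  by (simp add: list_cost_def)

lemma list_cost_Cons: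
  assumes "x \<notin> set xs"
  shows "list_cost \<tau> w a (x # xs) = w x * (a + \<tau> x) + list_cost \<tau> w (a + \<tau> x) xs"
proof -
  have "(\<Sum>i\<in>set xs. w i * (a + (\<Sum>k \<leftarrow> takeWhile (\<lambda>k. k \<noteq> i) (x # xs). \<tau> k) + \<tau> i)) =
        list_cost \<tau> w (a + \<tau> x) xs"
    unfolding list_cost_def using assms by (intro sum.cong) (auto simp: algebra_simps)
  then show ?thesis
    using assms by (simp add: list_cost_def)
qed

text \<open>The start time delays all tasks alike, so it enters linearly; this is what later carries
  expectations through the cost.\<close>

lemma list_cost_shift: "list_cost \<tau> w a xs = a * (\<Sum>i\<in>set xs. w i) + list_cost \<tau> w 0 xs"
  by (simp add: list_cost_def algebra_simps sum.distrib sum_distrib_left)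

lemma WCT_eq_list_cost: "WCT m \<tau> w t t' S = (\<Sum>j = 1..m. list_cost \<tau> w (t j + t' j) (S j))"
  by (simp add: WCT_def completion_time_def service_before_def list_cost_def)

lemma takeWhile_neq_upt:
  assumes "a \<le> i" and "i < b"
  shows "takeWhile (\<lambda>k. k \<noteq> i) [a..<b] = [a..<i]"
proof -
  have "[a..<b] = [a..<i] @ i # [Suc i..<b]"
    using assms upt_add_eq_append[of a i "b - i"] by (simp add: upt_conv_Cons[of i b])
  then show ?thesis
    by (simp only:) (subst takeWhile_append2, auto)
qed

lemma list_cost_upt:
  "list_cost \<tau> w a [1..<Suc n] = (\<Sum>i = 1..n. w i * (a + (\<Sum>k = 1..i. \<tau> k)))"
proof -
  have "(\<Sum>k \<leftarrow> takeWhile (\<lambda>k. k \<noteq> i) [1..<Suc n]. \<tau> k) + \<tau> i = (\<Sum>k = 1..i. \<tau> k)"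
    if "i \<in> {1..n}" for i
  proof -
    have "(\<Sum>k \<leftarrow> [1..<i]. \<tau> k) + \<tau> i = (\<Sum>k \<leftarrow> [1..<Suc i]. \<tau> k)"
      using that by simp
    also have "\<dots> = (\<Sum>k = 1..i. \<tau> k)"
      by (simp only: interv_sum_list_conv_sum_set_nat set_upt atLeastLessThanSuc_atLeastAtMost)
    finally show ?thesis
      using that takeWhile_neq_upt[of 1 i "Suc n"] by simp
  qed
  then show ?thesis
    unfolding list_cost_def set_upt atLeastLessThanSuc_atLeastAtMost
    by (intro sum.cong) (auto simp: add.assoc)
qed


section \<open>Lower bounds valid for every schedule\<close>

text \<open>Smith's rule: on one worker, serving by decreasing \<open>w / \<tau>\<close>, here by
  increasing index, is optimal. The left side is the cost of index order. By induction, the tail may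
  be put in index order, and moving the head \<open>x\<close> back to its place by index does not
  raise the cost.\<close>

lemma wspt_le_list_cost:
  assumes "distinct xs"
    and pos: "\<And>i. i \<in> set xs \<Longrightarrow> \<tau> i > 0"
    and ratio: "\<And>i k. i \<in> set xs \<Longrightarrow> k \<in> set xs \<Longrightarrow> i \<le> k \<Longrightarrow> w k / \<tau> k \<le> w i / \<tau> i"
  shows "(\<Sum>i\<in>set xs. w i * (\<Sum>k | k \<in> set xs \<and> k \<le> i. \<tau> k)) \<le> list_cost \<tau> w 0 xs"
  using assms
proof (induction xs)
  case Nil
  then show ?case by simp
next
  case (Cons x xs)
  let ?A = "set xs"
  have x: "x \<notin> ?A" using Cons.prems(1) by simp
  \<comment> \<open>For each pair of \<open>x\<close> and \<open>k\<close>, the left side is the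
    delay cost in index order, where exactly one of the two waits for the other. In the list
    \<open>x\<close> comes first, so \<open>k\<close> always waits for it.\<close>
  have swap: "(if k \<le> x then w x * \<tau> k else 0) + (if x \<le> k then w k * \<tau> x else 0) \<le> \<tau> x * w k"
    if "k \<in> ?A" for k
  proof (cases "k < x")
    case True
    then have "w x / \<tau> x \<le> w k / \<tau> k"
      using Cons.prems(3)[of k x] that by simp
    moreover have "\<tau> x > 0" "\<tau> k > 0"
      using Cons.prems(2) that by auto
    ultimately have "w x * \<tau> k \<le> \<tau> x * w k"
      by (simp add: field_simps)
    with True show ?thesis by simp
  next
    case False
    with that x have "x < k" by (metis linorder_neqE_nat)
    then show ?thesis by simp
  qed
  have new: "(\<Sum>k | k \<in> set (x # xs) \<and> k \<le> x. \<tau> k) = \<tau> x + (\<Sum>k\<in>?A. if k \<le> x then \<tau> k else 0)"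
  proof -
    have "{k. k \<in> set (x # xs) \<and> k \<le> x} = insert x {k\<in>?A. k \<le> x}" by auto
    then show ?thesis using x by (simp add: sum.inter_filter)
  qed
  have old: "(\<Sum>k | k \<in> set (x # xs) \<and> k \<le> i. \<tau> k) =
      (if x \<le> i then \<tau> x else 0) + (\<Sum>k | k \<in> ?A \<and> k \<le> i. \<tau> k)" for i
  proof -
    have "{k. k \<in> set (x # xs) \<and> k \<le> i} = (if x \<le> i then {x} else {}) \<union> {k\<in>?A. k \<le> i}" by auto
    then show ?thesis using x by (auto simp: sum.union_disjoint)
  qed
  have "(\<Sum>i\<in>set (x # xs). w i * (\<Sum>k | k \<in> set (x # xs) \<and> k \<le> i. \<tau> k)) =
      w x * (\<Sum>k | k \<in> set (x # xs) \<and> k \<le> x. \<tau> k) +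
      (\<Sum>i\<in>?A. w i * (\<Sum>k | k \<in> set (x # xs) \<and> k \<le> i. \<tau> k))"
    using x by simp
  also have "\<dots> = w x * \<tau> x +
      (\<Sum>k\<in>?A. (if k \<le> x then w x * \<tau> k else 0) + (if x \<le> k then w k * \<tau> x else 0)) +
      (\<Sum>i\<in>?A. w i * (\<Sum>k | k \<in> ?A \<and> k \<le> i. \<tau> k))"
    unfolding new old
    by (simp add: distrib_left sum.distrib sum_distrib_left if_distrib[of "\<lambda>z. _ * z"] cong: if_cong)
  also have "\<dots> \<le> w x * \<tau> x + (\<Sum>k\<in>?A. \<tau> x * w k) + list_cost \<tau> w 0 xs"
    using Cons by (intro add_mono sum_mono swap order_refl) auto
  also have "\<dots> = list_cost \<tau> w 0 (x # xs)"
    using list_cost_Cons[OF x, of \<tau> w 0] list_cost_shift[of \<tau> w "\<tau> x" xs]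
    by (simp add: sum_distrib_left)
  finally show ?case .
qed

section \<open>Convexity of the cost as a quadratic form in the service times\<close>

text \<open>The kernel \<open>min (\<rho> i) (\<rho> k)\<close> is positive semidefinite, so its quadratic form is
  convex. In the Abel-summed form below the excess over the \<open>j\<close>-average is a
  combination, with the nonnegative weights \<open>\<rho> i - \<rho> (i + 1)\<close>, of Cauchy-Schwarz defects.\<close>

lemma abel_quadratic_convex:
  fixes \<rho> :: "nat \<Rightarrow> real" and y :: "'j \<Rightarrow> nat \<Rightarrow> real"
  assumes nonneg: "\<And>i. i \<in> {1..n} \<Longrightarrow> 0 \<le> \<rho> i"
    and anti: "\<And>i k. i \<in> {1..n} \<Longrightarrow> k \<in> {1..n} \<Longrightarrow> i \<le> k \<Longrightarrow> \<rho> k \<le> \<rho> i"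
  defines "q \<equiv> \<lambda>n x. \<Sum>i = 1..n. \<rho> i * ((\<Sum>k = 1..i. x k)\<^sup>2 - (\<Sum>k = 1..<i. x k)\<^sup>2)"
  shows "q n (\<lambda>i. \<Sum>j\<in>J. y j i) \<le> real (card J) * (\<Sum>j\<in>J. q n (y j))"
proof -
  let ?z = "\<lambda>i. \<Sum>j\<in>J. y j i"
  define D where "D l = real (card J) * (\<Sum>j\<in>J. (\<Sum>k = 1..l. y j k)\<^sup>2) - (\<Sum>k = 1..l. ?z k)\<^sup>2" for l
  have D: "D l \<ge> 0" for l
  proof -
    have "(\<Sum>k = 1..l. ?z k) = (\<Sum>j\<in>J. \<Sum>k = 1..l. y j k)"
      by (rule sum.swap)
    then show ?thesis
      using sum_squared_le_sum_of_squares[of "\<lambda>j. \<Sum>k = 1..l. y j k" J]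
      by (simp add: D_def mult.commute)
  qed
  have qS: "q (Suc l) x = q l x + \<rho> (Suc l) * ((\<Sum>k = 1..Suc l. x k)\<^sup>2 - (\<Sum>k = 1..l. x k)\<^sup>2)" for l x
    unfolding q_def by (simp only: sum.cl_ivl_Suc atLeastLessThanSuc_atLeastAtMost) simp
  \<comment> \<open>The surplus term \<open>\<rho> l * D l\<close> strengthens the claim for
    induction: since \<open>\<rho>\<close> decreases, it pays for the \<open>D l\<close> subtracted
    in the next increment.\<close>
  have "\<rho> l * D l \<le> real (card J) * (\<Sum>j\<in>J. q l (y j)) - q l ?z" if "l \<le> n" for l
    using that
  proof (induction l)
    case 0
    then show ?case by (simp add: D_def q_def)
  next
    case (Suc l)
    have "\<rho> (Suc l) * D l \<le> \<rho> l * D l"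
    \<comment> \<open>Nothing is assumed about \<open>\<rho> 0\<close>, but
      \<open>D 0 = 0\<close>.\<close>
    proof (cases "l = 0")
      case False
      then show ?thesis using Suc.prems D by (intro mult_right_mono anti) auto
    qed (simp add: D_def)
    moreover have "real (card J) * (\<Sum>j\<in>J. q (Suc l) (y j)) - q (Suc l) ?z =
        real (card J) * (\<Sum>j\<in>J. q l (y j)) - q l ?z + \<rho> (Suc l) * (D (Suc l) - D l)"
      unfolding qS D_def
      by (simp only: sum.distrib sum_distrib_left[symmetric] sum_subtractf) (simp only: algebra_simps)
    ultimately show ?case
      using Suc by (simp add: algebra_simps)
  qed
  from this[of n] have "\<rho> n * D n \<le> real (card J) * (\<Sum>j\<in>J. q n (y j)) - q n ?z" by simp
  moreover have "0 \<le> \<rho> n * D n"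
    using D nonneg[of n] by (cases "n = 0") (auto simp: D_def)
  ultimately show ?thesis by simp
qed

text \<open>For partial sums \<open>X\<close>, the last of which adds \<open>x i\<close>, the
  difference of squares is \<open>2 * x i * X - (x i)\<^sup>2\<close>. With
  \<open>\<rho> i = w i / \<tau> i\<close> the first sum becomes a cost in index order and the
  second the diagonal \<open>w i * \<tau> i\<close>.\<close>

lemma abel_quadratic_eq:
  fixes \<rho> x :: "nat \<Rightarrow> real"
  shows "(\<Sum>i = 1..n. \<rho> i * ((\<Sum>k = 1..i. x k)\<^sup>2 - (\<Sum>k = 1..<i. x k)\<^sup>2)) =
    2 * (\<Sum>i = 1..n. \<rho> i * x i * (\<Sum>k = 1..i. x k)) - (\<Sum>i = 1..n. \<rho> i * (x i)\<^sup>2)"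
proof -
  have "\<rho> i * ((\<Sum>k = 1..i. x k)\<^sup>2 - (\<Sum>k = 1..<i. x k)\<^sup>2) =
      2 * (\<rho> i * x i * (\<Sum>k = 1..i. x k)) - \<rho> i * (x i)\<^sup>2" if "i \<in> {1..n}" for i
  proof -
    have "(\<Sum>k = 1..i. x k) = (\<Sum>k = 1..<i. x k) + x i"
      using that by (cases i) (simp_all add: atLeastLessThanSuc_atLeastAtMost)
    then show ?thesis by (simp add: power2_eq_square algebra_simps)
  qed
  then show ?thesis
    by (simp add: sum_subtractf sum_distrib_left)
qed

text \<open>Padding with zeros outside \<open>A\<close> turns the task sets of all workers into
  vectors over the same range, so that they can be added up and compared by convexity.\<close>

lemma wspt_eq_quadratic:
  fixes \<tau> w :: "nat \<Rightarrow> real"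
  assumes A: "A \<subseteq> {1..n}" and pos: "\<And>i. i \<in> {1..n} \<Longrightarrow> \<tau> i > 0"
  defines "x \<equiv> \<lambda>i. if i \<in> A then \<tau> i else 0"
  shows "(\<Sum>i\<in>A. w i * (\<Sum>k | k \<in> A \<and> k \<le> i. \<tau> k)) =
    (\<Sum>i = 1..n. w i / \<tau> i * x i * (\<Sum>k = 1..i. x k))"
proof -
  have "w i / \<tau> i * x i * (\<Sum>k = 1..i. x k) =
      (if i \<in> A then w i * (\<Sum>k | k \<in> A \<and> k \<le> i. \<tau> k) else 0)" if "i \<in> {1..n}" for i
  proof -
    have "{k. k \<in> A \<and> k \<le> i} = {k\<in>{1..i}. k \<in> A}" using A by auto
    then have "(\<Sum>k | k \<in> A \<and> k \<le> i. \<tau> k) = (\<Sum>k = 1..i. x k)"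
      unfolding x_def by (simp only: sum.inter_filter finite_atLeastAtMost)
    then show ?thesis using pos[OF that] by (simp add: x_def)
  qed
  then have "(\<Sum>i = 1..n. w i / \<tau> i * x i * (\<Sum>k = 1..i. x k)) =
      (\<Sum>i = 1..n. if i \<in> A then w i * (\<Sum>k | k \<in> A \<and> k \<le> i. \<tau> k) else 0)"
    by (intro sum.cong) auto
  also have "\<dots> = (\<Sum>i | i \<in> {1..n} \<and> i \<in> A. w i * (\<Sum>k | k \<in> A \<and> k \<le> i. \<tau> k))"
    by (simp only: sum.inter_filter finite_atLeastAtMost)
  also have "{i. i \<in> {1..n} \<and> i \<in> A} = A" using A by auto
  finally show ?thesis by simp
qed

text \<open>Only the unique worker holding \<open>i\<close> contributes. In this form sums over the
  workers' task sets can be exchanged with sums over tasks.\<close>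

lemma valid_schedule_sum:
  fixes c :: real
  assumes "valid_schedule m n S" and "i \<in> {1..n}"
  shows "(\<Sum>j = 1..m. if i \<in> set (S j) then c else 0) = c"
proof -
  obtain j where j: "j \<in> {1..m}" "i \<in> set (S j)"
      and uniq: "\<And>l. l \<in> {1..m} \<Longrightarrow> i \<in> set (S l) \<Longrightarrow> l = j"
    using assms unfolding valid_schedule_def by blast
  have "(\<Sum>j = 1..m. if i \<in> set (S j) then c else 0) = (\<Sum>l = 1..m. if l = j then c else 0)"
  proof (rule sum.cong[OF refl])
    fix l assume "l \<in> {1..m}"
    then have "i \<in> set (S l) \<longleftrightarrow> l = j" using j(2) uniq by blast
    then show "(if i \<in> set (S l) then c else 0) = (if l = j then c else 0)" by simp
  qed
  also have "\<dots> = c" using j(1) by (simp only: sum.delta finite_atLeastAtMost if_True)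
  finally show ?thesis .
qed

text \<open>The padded vectors \<open>y j\<close> add up to \<open>\<tau>\<close>, where
  \<open>q\<close> has the value \<open>2 * M1 - D\<close>. By Smith's rule the values
  \<open>q (y j)\<close> add up to at most \<open>2 * C - D\<close>, the diagonals being shared out
  among the workers. Convexity gives \<open>2 * M1 - D \<le> m * (2 * C - D)\<close>, which is
  solved for \<open>C\<close>.\<close>

lemma eastman_even_isaacs:
  assumes m: "m \<ge> 1" and S: "valid_schedule m n S"
    and pos: "\<And>i. i \<in> {1..n} \<Longrightarrow> \<tau> i > 0 \<and> w i > 0"
    and ratio: "\<And>i k. i \<in> {1..n} \<Longrightarrow> k \<in> {1..n} \<Longrightarrow> i \<le> k \<Longrightarrow> w k / \<tau> k \<le> w i / \<tau> i"
  shows "(\<Sum>i = 1..n. w i * (\<Sum>k = 1..i. \<tau> k)) / m + (1 - 1 / m) / 2 * (\<Sum>i = 1..n. w i * \<tau> i)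
    \<le> (\<Sum>j = 1..m. list_cost \<tau> w 0 (S j))"
proof -
  define \<rho> where "\<rho> i = w i / \<tau> i" for i
  define y where "y j i = (if i \<in> set (S j) then \<tau> i else 0)" for j i
  define q where "q x = (\<Sum>i = 1..n. \<rho> i * ((\<Sum>k = 1..i. x k)\<^sup>2 - (\<Sum>k = 1..<i. x k)\<^sup>2))"
    for x :: "nat \<Rightarrow> real"
  define M1 where "M1 = (\<Sum>i = 1..n. w i * (\<Sum>k = 1..i. \<tau> k))"
  define D where "D = (\<Sum>i = 1..n. w i * \<tau> i)"
  define C where "C = (\<Sum>j = 1..m. list_cost \<tau> w 0 (S j))"
  have sub: "set (S j) \<subseteq> {1..n}" "distinct (S j)" if "j \<in> {1..m}" for j
    using S that by (auto simp: valid_schedule_def)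
  have ysum: "(\<Sum>j = 1..m. y j i) = \<tau> i" if "i \<in> {1..n}" for i
    unfolding y_def by (rule valid_schedule_sum[OF S that])
  have "q (\<lambda>i. \<Sum>j = 1..m. y j i) = q \<tau>"
    unfolding q_def by (intro sum.cong arg_cong2[of _ _ _ _ "(*)"] arg_cong2[of _ _ _ _ "(-)"]
        arg_cong[of _ _ "\<lambda>z. z\<^sup>2"] refl ysum) auto
  also have "q \<tau> = 2 * M1 - D"
  proof -
    have *: "\<rho> i * \<tau> i = w i" "\<rho> i * (\<tau> i)\<^sup>2 = w i * \<tau> i" if "i \<in> {1..n}" for i
      using pos[OF that] by (auto simp: \<rho>_def power2_eq_square)
    show ?thesis
      unfolding q_def abel_quadratic_eq M1_def D_def using * by simp
  qed
  finally have qz: "q (\<lambda>i. \<Sum>j = 1..m. y j i) = 2 * M1 - D" .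
  have "(\<Sum>j = 1..m. \<Sum>i = 1..n. \<rho> i * (y j i)\<^sup>2) = D"
  proof -
    have "(\<Sum>j = 1..m. \<Sum>i = 1..n. \<rho> i * (y j i)\<^sup>2) =
        (\<Sum>i = 1..n. \<Sum>j = 1..m. if i \<in> set (S j) then w i * \<tau> i else 0)"
      by (subst sum.swap, intro sum.cong refl)
        (use pos in \<open>auto simp: y_def \<rho>_def power2_eq_square less_imp_neq[symmetric]\<close>)
    also have "\<dots> = D"
      unfolding D_def by (intro sum.cong refl valid_schedule_sum[OF S])
    finally show ?thesis .
  qed
  moreover have "(\<Sum>j = 1..m. \<Sum>i = 1..n. \<rho> i * y j i * (\<Sum>k = 1..i. y j k)) \<le> C"
    unfolding C_def
  proof (rule sum_mono)
    fix j assume j: "j \<in> {1..m}"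
    have "(\<Sum>i = 1..n. \<rho> i * y j i * (\<Sum>k = 1..i. y j k)) =
        (\<Sum>i\<in>set (S j). w i * (\<Sum>k | k \<in> set (S j) \<and> k \<le> i. \<tau> k))"
      using wspt_eq_quadratic[OF sub(1)[OF j], of \<tau> w] pos by (simp add: \<rho>_def y_def)
    also have "\<dots> \<le> list_cost \<tau> w 0 (S j)"
      using sub[OF j] pos ratio by (intro wspt_le_list_cost) blast+
    finally show "(\<Sum>i = 1..n. \<rho> i * y j i * (\<Sum>k = 1..i. y j k)) \<le> list_cost \<tau> w 0 (S j)" .
  qed
  ultimately have "(\<Sum>j = 1..m. q (y j)) \<le> 2 * C - D"
    unfolding q_def abel_quadratic_eq sum_subtractf sum_distrib_left[symmetric] by linarith
  moreover have "q (\<lambda>i. \<Sum>j = 1..m. y j i) \<le> real (card {1..m}) * (\<Sum>j = 1..m. q (y j))"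
    unfolding q_def using pos ratio
    by (intro abel_quadratic_convex) (auto simp: \<rho>_def less_imp_le)
  ultimately have "2 * M1 - D \<le> m * (2 * C - D)"
    unfolding qz by (simp add: order_trans mult_left_mono)
  then have "M1 / m + (1 - 1 / m) / 2 * D \<le> C"
    using m by (simp add: field_simps)
  then show ?thesis
    by (simp add: M1_def D_def C_def)
qed

section \<open>Lower bound by pure service times\<close>

lemma service_le_list_cost:
  assumes "\<And>i. i \<in> set xs \<Longrightarrow> 0 < \<tau> i \<and> 0 < w i"
  shows "(\<Sum>i\<in>set xs. w i * \<tau> i) \<le> list_cost \<tau> w 0 xs"
  unfolding list_cost_def
proof (intro sum_mono mult_left_mono)
  fix i assume i: "i \<in> set xs"
  then show "0 \<le> w i" using assms by (simp add: less_imp_le)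
  have "0 \<le> (\<Sum>k \<leftarrow> takeWhile (\<lambda>k. k \<noteq> i) xs. \<tau> k)"
    using assms by (intro sum_list_nonneg) (auto dest!: set_takeWhileD intro: less_imp_le)
  then show "\<tau> i \<le> 0 + (\<Sum>k \<leftarrow> takeWhile (\<lambda>k. k \<noteq> i) xs. \<tau> k) + \<tau> i" by simp
qed

lemma list_cost_mono:
  assumes "0 \<le> a" and "\<And>i. i \<in> set xs \<Longrightarrow> 0 < \<tau> i \<and> 0 < w i"
  shows "list_cost \<tau> w 0 xs \<le> list_cost \<tau> w a xs"
  using assms by (subst (2) list_cost_shift) (simp add: sum_nonneg less_imp_le)

lemma list_cost_nonneg:
  assumes "0 \<le> a" and "\<And>i. i \<in> set xs \<Longrightarrow> 0 < \<tau> i \<and> 0 < w i"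
  shows "0 \<le> list_cost \<tau> w a xs"
proof -
  have "0 \<le> (\<Sum>i\<in>set xs. w i * \<tau> i)"
    using assms(2) by (intro sum_nonneg) (simp add: less_imp_le)
  also have "\<dots> \<le> list_cost \<tau> w 0 xs"
    by (intro service_le_list_cost assms)
  also have "\<dots> \<le> list_cost \<tau> w a xs"
    by (intro list_cost_mono assms)
  finally show ?thesis .
qed

lemma valid_schedule_service_le:
  assumes S: "valid_schedule m n S"
    and pos: "\<And>i. i \<in> {1..n} \<Longrightarrow> \<tau> i > 0 \<and> w i > 0"
  shows "(\<Sum>i = 1..n. w i * \<tau> i) \<le> (\<Sum>j = 1..m. list_cost \<tau> w 0 (S j))"
proof -
  have sub: "set (S j) \<subseteq> {1..n}" if "j \<in> {1..m}" for j
    using S that by (auto simp: valid_schedule_def)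
  have "(\<Sum>i = 1..n. w i * \<tau> i) = (\<Sum>i = 1..n. \<Sum>j = 1..m. if i \<in> set (S j) then w i * \<tau> i else 0)"
    by (intro sum.cong refl valid_schedule_sum[OF S, symmetric])
  also have "\<dots> = (\<Sum>j = 1..m. \<Sum>i = 1..n. if i \<in> set (S j) then w i * \<tau> i else 0)"
    by (rule sum.swap)
  also have "\<dots> = (\<Sum>j = 1..m. \<Sum>i\<in>set (S j). w i * \<tau> i)"
  proof (rule sum.cong[OF refl])
    fix j assume j: "j \<in> {1..m}"
    have "(\<Sum>i = 1..n. if i \<in> set (S j) then w i * \<tau> i else 0) =
        (\<Sum>i | i \<in> {1..n} \<and> i \<in> set (S j). w i * \<tau> i)"
      by (simp only: sum.inter_filter finite_atLeastAtMost)
    also have "{i. i \<in> {1..n} \<and> i \<in> set (S j)} = set (S j)" using sub[OF j] by auto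
    finally show "(\<Sum>i = 1..n. if i \<in> set (S j) then w i * \<tau> i else 0) =
        (\<Sum>i\<in>set (S j). w i * \<tau> i)" .
  qed
  also have "\<dots> \<le> (\<Sum>j = 1..m. list_cost \<tau> w 0 (S j))"
    using sub pos by (intro sum_mono service_le_list_cost) blast+
  finally show ?thesis .
qed


section \<open>Greedy plans and the CosMOS run\<close>

lemma greedy_plan_subset: "greedy_plan \<tau> R EW ts P \<Longrightarrow> set (P j) \<subseteq> set ts"
  by (induction rule: greedy_plan.induct) (auto split: if_splits)

text \<open>An argmin does not change under a common shift, and only loads of workers in
  \<open>R\<close> are compared. The first fact normalizes \<open>initial_EW\<close>; the second,
  with \<open>c = 0\<close>, allows a change of load outside \<open>R\<close>.\<close>

lemma greedy_plan_shift:
  assumes "greedy_plan \<tau> R EW ts P" and "\<And>k. k \<in> R \<Longrightarrow> EW' k = EW k + c"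
  shows "greedy_plan \<tau> R EW' ts P"
  using assms
proof (induction arbitrary: EW' rule: greedy_plan.induct)
  case (no_task EW)
  show ?case by (rule greedy_plan.no_task)
next
  case (assign_task EW kmin i ts P)
  show ?case
  proof (rule greedy_plan.assign_task)
    show "is_arg_min EW' (\<lambda>k. k \<in> R) kmin"
      using assign_task.hyps(1) by (auto simp: is_arg_min_linorder assign_task.prems)
    then have "kmin \<in> R" by (simp add: is_arg_min_def)
    then show "greedy_plan \<tau> R (EW'(kmin := EW' kmin + \<tau> i)) ts P"
      by (intro assign_task.IH) (simp add: assign_task.prems)
  qed
qed

text \<open>The least load is at most the average \<open>A / r\<close>, with \<open>A\<close> the
  total load and \<open>r = card R\<close>, so the task finishes by \<open>A / r + \<tau> i = (A +
  \<tau> i) / r + (1 - 1 / r) * \<tau> i\<close>. Whichever worker is chosen, the average grows by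
  \<open>\<tau> i / r\<close>. Thus the averages evolve like the load of one worker that is
  \<open>r\<close> times as fast.\<close>

lemma greedy_plan_cost_le:
  assumes "greedy_plan \<tau> R EW ts P" and "finite R" and "distinct ts"
    and "\<And>i. i \<in> set ts \<Longrightarrow> 0 \<le> w i"
  shows "(\<Sum>j\<in>R. list_cost \<tau> w (EW j) (P j)) \<le>
    list_cost (\<lambda>i. \<tau> i / card R) w ((\<Sum>j\<in>R. EW j) / card R) ts +
    (1 - 1 / card R) * (\<Sum>i\<in>set ts. w i * \<tau> i)"
  using assms
proof (induction rule: greedy_plan.induct)
  case (no_task EW)
  then show ?case by simp
next
  case (assign_task EW l i ts P)
  let ?EW = "EW(l := EW l + \<tau> i)" and ?r = "real (card R)" and ?A = "\<Sum>j\<in>R. EW j"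
  have l: "l \<in> R" and min: "\<And>j. j \<in> R \<Longrightarrow> EW l \<le> EW j"
    using assign_task.hyps(1) by (auto simp: is_arg_min_linorder)
  have r: "?r > 0" using l assign_task.prems(1) by (auto simp: card_gt_0_iff)
  have i: "i \<notin> set ts" "i \<notin> set (P l)"
    using assign_task.prems(2) greedy_plan_subset[OF assign_task.hyps(2)] by auto
  have "?r * EW l \<le> ?A"
    using sum_mono[of R "\<lambda>_. EW l" EW] min by simp
  then have avg: "EW l \<le> ?A / ?r"
    using r by (simp add: field_simps)
  have A: "(\<Sum>j\<in>R. ?EW j) = ?A + \<tau> i"
    using l assign_task.prems(1) by (simp add: sum.remove[of R l])
  have "(\<Sum>j\<in>R. list_cost \<tau> w (EW j) ((P(l := i # P l)) j)) =
      w i * (EW l + \<tau> i) + (\<Sum>j\<in>R. list_cost \<tau> w (?EW j) (P j))"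
    using l assign_task.prems(1) i by (simp add: sum.remove[of R l] list_cost_Cons)
  also have "\<dots> \<le> w i * (?A / ?r + \<tau> i) + (\<Sum>j\<in>R. list_cost \<tau> w (?EW j) (P j))"
    using avg assign_task.prems(3)[of i] by (intro add_mono mult_left_mono) auto
  also have "\<dots> \<le> w i * (?A / ?r + \<tau> i) +
      (list_cost (\<lambda>i. \<tau> i / ?r) w ((?A + \<tau> i) / ?r) ts + (1 - 1 / ?r) * (\<Sum>i\<in>set ts. w i * \<tau> i))"
    using assign_task.IH assign_task.prems unfolding A by simp
  also have "\<dots> = list_cost (\<lambda>i. \<tau> i / ?r) w (?A / ?r) (i # ts) +
      (1 - 1 / ?r) * (\<Sum>i\<in>set (i # ts). w i * \<tau> i)"
    using i by (simp add: list_cost_Cons add_divide_distrib algebra_simps)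
  finally show ?case .
qed

section \<open>Replanning and tie-breaking\<close>

lemma is_arg_min_mset_eq:
  fixes f g :: "'b \<Rightarrow> real"
  assumes "finite R" and "is_arg_min f (\<lambda>k. k \<in> R) a" and "is_arg_min g (\<lambda>k. k \<in> R) b"
    and "image_mset f (mset_set R) = image_mset g (mset_set R)"
  shows "f a = g b"
proof -
  have "f ` R = g ` R"
    using assms(1,4) by (metis finite_set_mset_mset_set set_image_mset)
  moreover have "f a = Min (f ` R)" "g b = Min (g ` R)"
    using assms(1-3) by (auto simp: is_arg_min_linorder intro!: Min_eqI[symmetric])
  ultimately show ?thesis by simp
qed

lemma image_mset_update:
  assumes "finite R" and "a \<in> R"
  shows "image_mset (f(a := v)) (mset_set R) = add_mset v (image_mset f (mset_set R) - {#f a#})"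
proof -
  have "mset_set R = add_mset a (mset_set (R - {a}))"
    using assms by (simp add: mset_set.remove)
  moreover have "image_mset (f(a := v)) (mset_set (R - {a})) = image_mset f (mset_set (R - {a}))"
    using assms by (intro image_mset_cong) auto
  ultimately show ?thesis by simp
qed

text \<open>A replanned run may break ties differently from the discarded plan, but the multiset
  of loads of the remaining workers evolves identically, so its choices stay greedy with
  respect to worker \<open>j\<close> as well.\<close>

lemma greedy_plan_merge:
  assumes "greedy_plan \<tau> R EW ts P" and "j \<in> R" and "finite R" and "distinct ts"
    and "greedy_plan \<tau> (R - {j}) EW' (filter (\<lambda>i. i \<notin> set (P j)) ts) Q"
    and "image_mset EW (mset_set (R - {j})) = image_mset EW' (mset_set (R - {j}))"
    and "EW' j = EW j"
  shows "greedy_plan \<tau> R EW' ts (Q(j := P j))"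
  using assms
proof (induction arbitrary: EW' Q rule: greedy_plan.induct)
  case (no_task EW)
  then have "Q = (\<lambda>_. [])"
    by (auto elim: greedy_plan.cases)
  then show ?case
    by (auto simp: fun_upd_idem intro: greedy_plan.no_task)
next
  case (assign_task EW l i ts P)
  note prems = assign_task.prems
  have l: "l \<in> R" and min: "\<And>k. k \<in> R \<Longrightarrow> EW l \<le> EW k"
    using assign_task.hyps(1) by (auto simp: is_arg_min_linorder)
  have i: "i \<notin> set ts" "i \<notin> set (P j)"
    using prems(3) greedy_plan_subset[OF assign_task.hyps(2)] by auto
  have fin: "finite (R - {j})" using prems(2) by simp
  have img: "EW ` (R - {j}) = EW' ` (R - {j})"
    using prems(5) fin by (metis finite_set_mset_mset_set set_image_mset)
  show ?case
  proof (cases "l = j")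
    \<comment> \<open>The task goes to \<open>j\<close> and is filtered out of the replanned list,
      so \<open>Q\<close> is unchanged. It remains to see that \<open>j\<close> is also minimal for
      \<open>EW'\<close>, whose values on the other workers are the same as those of
      \<open>EW\<close>.\<close>
    case True
    have "filter (\<lambda>k. k \<notin> set ((P(l := i # P l)) j)) (i # ts) = filter (\<lambda>k. k \<notin> set (P j)) ts"
      using True i by (auto intro!: filter_cong)
    then have Q: "greedy_plan \<tau> (R - {j}) EW' (filter (\<lambda>k. k \<notin> set (P j)) ts) Q"
      using prems(4) by simp
    let ?EW = "EW(l := EW l + \<tau> i)" and ?EW' = "EW'(j := EW' j + \<tau> i)"
    have eq: "greedy_plan \<tau> (R - {j}) ?EW' (filter (\<lambda>k. k \<notin> set (P j)) ts) Q"
      by (rule greedy_plan_shift[OF Q, where c = 0]) auto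
    have am: "is_arg_min EW' (\<lambda>k. k \<in> R) j"
    proof -
      have "EW' j \<le> EW' k" if "k \<in> R" for k
      proof (cases "k = j")
        case False
        then have "EW' k \<in> EW ` (R - {j})" using that img by blast
        then show ?thesis using min True prems(6) by auto
      qed simp
      then show ?thesis using prems(1) by (simp add: is_arg_min_linorder)
    qed
    have "greedy_plan \<tau> R ?EW' ts (Q(j := P j))"
    proof (rule assign_task.IH[OF prems(1,2) _ eq])
      have "image_mset ?EW (mset_set (R - {j})) = image_mset EW (mset_set (R - {j}))"
        "image_mset ?EW' (mset_set (R - {j})) = image_mset EW' (mset_set (R - {j}))"
        using True fin by (auto intro!: image_mset_cong)
      then show "image_mset ?EW (mset_set (R - {j})) = image_mset ?EW' (mset_set (R - {j}))"
        using prems(5) by simp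
    qed (use True prems in auto)
    from greedy_plan.assign_task[OF am this]
    have "greedy_plan \<tau> R EW' (i # ts) ((Q(j := P j))(j := i # P j))" by simp
    moreover have "(Q(j := P j))(j := i # P j) = Q(j := (P(l := i # P l)) j)"
      using True by simp
    ultimately show ?thesis by (simp only:)
  next
    case False
    have "filter (\<lambda>k. k \<notin> set ((P(l := i # P l)) j)) (i # ts) = i # filter (\<lambda>k. k \<notin> set (P j)) ts"
      using False i by auto
    with prems(4) have "greedy_plan \<tau> (R - {j}) EW' (i # filter (\<lambda>k. k \<notin> set (P j)) ts) Q"
      by simp
    then obtain l' Q' where l': "is_arg_min EW' (\<lambda>k. k \<in> R - {j}) l'"
      and Q': "greedy_plan \<tau> (R - {j}) (EW'(l' := EW' l' + \<tau> i)) (filter (\<lambda>k. k \<notin> set (P j)) ts) Q'"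
      and Q: "Q = Q'(l' := i # Q' l')"
      by (cases rule: greedy_plan.cases) auto
    have l'R: "l' \<in> R" "l' \<noteq> j" using l' by (auto simp: is_arg_min_linorder)
    have "is_arg_min EW (\<lambda>k. k \<in> R - {j}) l"
      using l min False by (auto simp: is_arg_min_linorder)
    \<comment> \<open>The two plans may pick different workers \<open>l\<close> and
      \<open>l'\<close>, but both pick the same least load. Replacing it by the same larger value
      keeps the multisets of loads equal.\<close>
    then have same: "EW l = EW' l'"
      using is_arg_min_mset_eq[OF fin _ l' prems(5)] by blast
    have am: "is_arg_min EW' (\<lambda>k. k \<in> R) l'"
      using l' same min[OF prems(1)] prems(6) by (auto simp: is_arg_min_linorder)
    have "greedy_plan \<tau> R (EW'(l' := EW' l' + \<tau> i)) ts (Q'(j := P j))"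
    proof (rule assign_task.IH)
      show "image_mset (EW(l := EW l + \<tau> i)) (mset_set (R - {j})) =
          image_mset (EW'(l' := EW' l' + \<tau> i)) (mset_set (R - {j}))"
        using l l'R False fin by (simp add: image_mset_update same prems(5))
      show "greedy_plan \<tau> (R - {j}) (EW'(l' := EW' l' + \<tau> i)) (filter (\<lambda>k. k \<notin> set (P j)) ts) Q'"
        by (rule Q')
    qed (use prems False l'R in auto)
    from greedy_plan.assign_task[OF am this]
    have "greedy_plan \<tau> R EW' (i # ts) ((Q'(j := P j))(l' := i # Q' l'))"
      using l'R by simp
    moreover have "(Q'(j := P j))(l' := i # Q' l') = Q(j := (P(l := i # P l)) j)"
      using False l'R by (auto simp: Q)
    ultimately show ?thesis by (simp only:)
  qed
qed

lemma greedy_plan_singleton: "greedy_plan \<tau> R EW ts P \<Longrightarrow> R = {j} \<Longrightarrow> P j = ts"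
  by (induction rule: greedy_plan.induct) (auto simp: is_arg_min_linorder)

text \<open>Adding \<open>1 / rate j\<close> to every entry of \<open>initial_EW rate j\<close>
  gives \<open>2 / rate k\<close> for all \<open>k\<close>, including \<open>k = j\<close>. All
  meetings therefore plan with the same initial loads, and merging joins the part handed to
  \<open>j\<close> with the run on the remaining workers.\<close>

lemma cosmos_run_greedy_plan:
  assumes "cosmos_run rate \<tau> js ts S" and "js \<noteq> []" and "distinct js" and "distinct ts"
  shows "greedy_plan \<tau> (set js) (\<lambda>k. 2 / rate k) ts S"
  using assms
proof (induction rule: cosmos_run.induct)
  case (no_worker ts)
  then show ?case by simp
next
  case (meet_worker j js ts P S)
  let ?EW = "\<lambda>k. 2 / rate k" and ?ts = "filter (\<lambda>i. i \<notin> set (P j)) ts"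
  have P: "greedy_plan \<tau> (set (j # js)) ?EW ts P"
    by (rule greedy_plan_shift[OF meet_worker.hyps(1), where c = "1 / rate j"])
      (simp add: initial_EW_def)
  have S: "greedy_plan \<tau> (set js) ?EW ?ts S"
  proof (cases "js = []")
    \<comment> \<open>The last worker receives every remaining task, so the empty set of workers
      only has to plan an empty list.\<close>
    case True
    then have "P j = ts" using greedy_plan_singleton[OF P] by simp
    then have "?ts = []" by simp
    moreover have "S = (\<lambda>_. [])"
      using meet_worker.hyps(2) True by (auto elim: cosmos_run.cases)
    ultimately show ?thesis by (auto intro: greedy_plan.no_task)
  next
    case False
    then show ?thesis using meet_worker.IH meet_worker.prems by simp
  qed
  moreover have "set (j # js) - {j} = set js" using meet_worker.prems by auto
  ultimately show ?case
    using meet_worker.prems by (intro greedy_plan_merge[OF P]) simp_all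
qed


section \<open>Expected costs\<close>

text \<open>\<open>L\<close> stands for any number above both lower bounds. The greedy bound
  contains \<open>(1 - 1 / m) * D\<close>: one half is absorbed together with \<open>M1 / m\<close>
  by \<open>L2\<close>, the other half is at most \<open>(1 - 1 / m) / 2 * L\<close> by
  \<open>L1\<close>. This is the source of the factor
  \<open>3 / 2 - 1 / (2 * m) = 1 + (1 - 1 / m) / 2\<close>.\<close>

lemma cosmos_cost_le:
  fixes rate \<tau> w :: "nat \<Rightarrow> real"
  assumes m: "m \<ge> 1" and n: "n \<ge> 1"
    and rate: "\<And>j. j \<in> {1..m} \<Longrightarrow> rate j > 0"
    and pos: "\<And>i. i \<in> {1..n} \<Longrightarrow> \<tau> i > 0 \<and> w i > 0"
    and S: "cosmos_schedule m n rate \<tau> S"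
    and L1: "(\<Sum>i = 1..n. w i * \<tau> i) \<le> L"
    and L2: "(\<Sum>i = 1..n. w i * (\<Sum>k = 1..i. \<tau> k)) / m +
      (1 - 1 / m) / 2 * (\<Sum>i = 1..n. w i * \<tau> i) \<le> L"
  shows "(\<Sum>j = 1..m. list_cost \<tau> w (2 / rate j) (S j)) \<le>
    (3 / 2 - 1 / (2 * m)) * (L + n * Max (w ` {1..n}) * (2 / Min (rate ` {1..m})))"
proof -
  define D where "D = (\<Sum>i = 1..n. w i * \<tau> i)"
  define M1 where "M1 = (\<Sum>i = 1..n. w i * (\<Sum>k = 1..i. \<tau> k))"
  define B where "B = n * Max (w ` {1..n}) * (2 / Min (rate ` {1..m}))"
  define a where "a = (\<Sum>j = 1..m. 2 / rate j) / m"
  have sets: "set [1..<Suc m] = {1..m}" "set [1..<Suc n] = {1..n}" by auto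
  have rmin: "Min (rate ` {1..m}) > 0" using m rate by simp
  \<comment> \<open>The average initial load is bounded by that of the slowest worker; multiplied by
    the total weight it yields \<open>B\<close>.\<close>
  have "a \<le> 2 / Min (rate ` {1..m})"
  proof -
    have "(\<Sum>j = 1..m. 2 / rate j) \<le> (\<Sum>j = 1..m. 2 / Min (rate ` {1..m}))"
      using rmin rate by (intro sum_mono divide_left_mono mult_pos_pos) auto
    then show ?thesis using m by (simp add: a_def divide_le_eq mult.commute)
  qed
  moreover have "(\<Sum>i = 1..n. w i) \<le> n * Max (w ` {1..n})"
    using sum_mono[of "{1..n}" w "\<lambda>_. Max (w ` {1..n})"] by simp
  moreover have "0 \<le> (\<Sum>i = 1..n. w i)"
    using pos by (intro sum_nonneg) (auto intro: less_imp_le)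
  ultimately have aW: "a * (\<Sum>i = 1..n. w i) \<le> B" and B: "B \<ge> 0"
    using rmin mult_mono[of a "2 / Min (rate ` {1..m})" "\<Sum>i = 1..n. w i" "n * Max (w ` {1..n})"]
    by (auto simp: B_def mult.commute intro: order_trans)
  have L: "L \<ge> 0"
    using L1 pos by (intro order_trans[OF sum_nonneg L1]) (auto intro: less_imp_le)
  have "greedy_plan \<tau> {1..m} (\<lambda>k. 2 / rate k) [1..<Suc n] S"
    using cosmos_run_greedy_plan[OF S[unfolded cosmos_schedule_def]] m unfolding sets by simp
  from greedy_plan_cost_le[OF this, of w]
  have "(\<Sum>j = 1..m. list_cost \<tau> w (2 / rate j) (S j)) \<le>
      list_cost (\<lambda>i. \<tau> i / m) w a [1..<Suc n] + (1 - 1 / m) * D"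
    using pos unfolding sets D_def a_def
    by (simp only: finite_atLeastAtMost distinct_upt card_atLeastAtMost diff_Suc_1) (simp add: less_imp_le)
  also have "list_cost (\<lambda>i. \<tau> i / m) w a [1..<Suc n] = a * (\<Sum>i = 1..n. w i) + M1 / m"
    unfolding list_cost_upt M1_def
    by (simp add: distrib_left sum.distrib sum_distrib_left sum_divide_distrib mult.commute)
  also have "a * (\<Sum>i = 1..n. w i) + M1 / m + (1 - 1 / m) * D \<le> B + (L + (1 - 1 / m) / 2 * D)"
    using aW L2 unfolding M1_def[symmetric] D_def[symmetric] by argo
  also have "(1 - 1 / m) / 2 * D \<le> (1 - 1 / m) / 2 * L"
    using L1 m by (intro mult_left_mono) (auto simp: D_def)
  also have "B + (L + (1 - 1 / m) / 2 * L) \<le> (3 / 2 - 1 / (2 * m)) * (L + B)"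
  proof -
    have "(1 - 1 / real m) / 2 * B \<ge> 0" using B m by simp
    then have "B + (L + (1 - 1 / real m) / 2 * L) \<le> (1 + (1 - 1 / real m) / 2) * (L + B)"
      by (simp only: distrib_right distrib_left mult_1_left)
    also have "1 + (1 - 1 / real m) / 2 = 3 / 2 - 1 / (2 * m)" by (simp add: field_simps)
    finally show ?thesis .
  qed
  finally show ?thesis by (simp add: B_def)
qed

section \<open>Exponential meeting times\<close>

lemma (in prob_space) exponential_nonneg_integrable:
  assumes "0 < l" and D: "distributed M lborel X (exponential_density l)"
  shows "AE x in M. 0 \<le> X x" and "integrable M X"
proof -
  show "AE x in M. 0 \<le> X x"
    by (subst distributed_AE2[OF D]) (auto simp: exponential_density_def)
  show "integrable M X"
    \<comment> \<open>The exponential density is the Erlang density with index 0, and integrability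
      of \<open>X\<close> is that of its first moment.\<close>
    using erlang_ith_moment_integrable[OF assms, of 1] by simp
qed

text \<open>For a fixed schedule the cost is affine in the meeting times, so linearity replaces
  \<open>t j + t' j\<close> by its mean \<open>2 / rate j\<close>. The CosMOS schedule is fixed in
  this sense, whereas the optimal one varies with \<open>x\<close>.\<close>

lemma (in prob_space) expected_WCT:
  assumes rate: "\<And>j. j \<in> {1..m} \<Longrightarrow> rate j > 0"
    and t: "\<And>j. j \<in> {1..m} \<Longrightarrow> distributed M lborel (t j) (exponential_density (rate j))"
    and t': "\<And>j. j \<in> {1..m} \<Longrightarrow> distributed M lborel (t' j) (exponential_density (rate j))"
  shows "has_bochner_integral M (\<lambda>x. WCT m \<tau> w (\<lambda>j. t j x) (\<lambda>j. t' j x) S)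
    (\<Sum>j = 1..m. list_cost \<tau> w (2 / rate j) (S j))"
proof -
  have "has_bochner_integral M (\<lambda>x. list_cost \<tau> w (t j x + t' j x) (S j))
      (list_cost \<tau> w (2 / rate j) (S j))" if j: "j \<in> {1..m}" for j
  proof -
    have "has_bochner_integral M (t j) (1 / rate j)" "has_bochner_integral M (t' j) (1 / rate j)"
      using exponential_nonneg_integrable(2)[OF rate[OF j] t[OF j]]
        exponential_nonneg_integrable(2)[OF rate[OF j] t'[OF j]]
        exponential_distributed_expectation[OF rate[OF j] t[OF j]]
        exponential_distributed_expectation[OF rate[OF j] t'[OF j]]
      by (auto simp: has_bochner_integral_iff)
    from has_bochner_integral_add[OF this]
    have "has_bochner_integral M (\<lambda>x. t j x + t' j x) (2 / rate j)" by simp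
    then have *: "has_bochner_integral M (\<lambda>x. (t j x + t' j x) * (\<Sum>i\<in>set (S j). w i) + list_cost \<tau> w 0 (S j))
        (2 / rate j * (\<Sum>i\<in>set (S j). w i) + list_cost \<tau> w 0 (S j))"
      by (intro has_bochner_integral_add has_bochner_integral_mult_left)
        (simp_all add: has_bochner_integral_iff prob_space)
    show ?thesis
      by (subst (1 2) list_cost_shift) (rule *)
  qed
  then show ?thesis
    unfolding WCT_eq_list_cost by (rule has_bochner_integral_sum)
qed

section \<open>Comparison with the optimum, for the ratio of expectations and the expected
  ratio\<close>

theorem theorem5:
  fixes M :: "'a measure"
    and m n :: nat
    and rate \<tau> w :: "nat \<Rightarrow> real"
    and t t' :: "nat \<Rightarrow> 'a \<Rightarrow> real"
    and S_OPT :: "'a \<Rightarrow> schedule"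
    and S_CosMOS :: schedule
    and w_max w_min rate_max rate_min \<tau>_min :: real
    and WCT_CosMOS WCT_OPT :: "'a \<Rightarrow> real"
  assumes "prob_space M"
    and "m \<ge> 1" and "n \<ge> 1"
    and "\<forall>j\<in>{1..m}. rate j > 0"
    and "\<forall>j\<in>{1..m}. \<forall>k\<in>{1..m}. j \<le> k \<longrightarrow> rate j \<ge> rate k"
    and "\<forall>i\<in>{1..n}. \<tau> i > 0 \<and> w i > 0"
    and "\<forall>i\<in>{1..n}. \<forall>k\<in>{1..n}. i \<le> k \<longrightarrow> w i / \<tau> i \<ge> w k / \<tau> k"
    and "\<forall>j\<in>{1..m}. distributed M lborel (t j) (exponential_density (rate j))"
    and "\<forall>j\<in>{1..m}. distributed M lborel (t' j) (exponential_density (rate j))"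
    and "cosmos_schedule m n rate \<tau> S_CosMOS"
    and "\<forall>x\<in>space M. optimal_schedule m n \<tau> w (\<lambda>j. t j x) (\<lambda>j. t' j x) (S_OPT x)"
  defines "w_max \<equiv> Max (w ` {1..n})" and "w_min \<equiv> Min (w ` {1..n})"
    and "rate_max \<equiv> Max (rate ` {1..m})" and "rate_min \<equiv> Min (rate ` {1..m})"
    and "\<tau>_min \<equiv> Min (\<tau> ` {1..n})"
    and "WCT_CosMOS \<equiv> (\<lambda>x. WCT m \<tau> w (\<lambda>j. t j x) (\<lambda>j. t' j x) S_CosMOS)"
    and "WCT_OPT \<equiv> (\<lambda>x. WCT m \<tau> w (\<lambda>j. t j x) (\<lambda>j. t' j x) (S_OPT x))"
  shows "\<forall>\<alpha>. \<alpha> = max (3 / 2) (w_max * rate_max / (w_min * rate_min)) \<or>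
             (\<tau>_min > 2 / rate_max \<and> \<alpha> = 2 - 1 / real m) \<longrightarrow>
           (\<integral>x. WCT_CosMOS x \<partial>M) / (\<integral>x. WCT_OPT x \<partial>M)
             \<le> \<alpha> * (1 + real n * w_max * (2 / rate_min) / (w_min * (\<Sum>i = 1..n. \<tau> i))) \<and>
           (\<integral>x. WCT_CosMOS x / WCT_OPT x \<partial>M)
             \<le> \<alpha> * (1 + real n * w_max * (2 / rate_min) / (w_min * (\<Sum>i = 1..n. \<tau> i)))"
proof -
  note wmax = \<open>w_max \<equiv> Max (w ` {1..n})\<close> and wmin = \<open>w_min \<equiv> Min (w ` {1..n})\<close>
    and rmin = \<open>rate_min \<equiv> Min (rate ` {1..m})\<close>
  note COS = \<open>WCT_CosMOS \<equiv> (\<lambda>x. WCT m \<tau> w (\<lambda>j. t j x) (\<lambda>j. t' j x) S_CosMOS)\<close>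
    and OPT = \<open>WCT_OPT \<equiv> (\<lambda>x. WCT m \<tau> w (\<lambda>j. t j x) (\<lambda>j. t' j x) (S_OPT x))\<close>
  interpret prob_space M by fact
  have m: "m \<ge> 1" and n: "n \<ge> 1" by fact+
  have rate: "rate j > 0" if "j \<in> {1..m}" for j using assms(4) that by blast
  have pos: "\<tau> i > 0 \<and> w i > 0" if "i \<in> {1..n}" for i using assms(6) that by blast
  have ratio: "w k / \<tau> k \<le> w i / \<tau> i" if "i \<in> {1..n}" "k \<in> {1..n}" "i \<le> k" for i k
    using assms(7) that by blast
  have t: "distributed M lborel (t j) (exponential_density (rate j))"
    and t': "distributed M lborel (t' j) (exponential_density (rate j))" if "j \<in> {1..m}" for j
    using assms(8,9) that by blast+
  define D where "D = (\<Sum>i = 1..n. w i * \<tau> i)"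
  define E where "E = (\<Sum>i = 1..n. w i * (\<Sum>k = 1..i. \<tau> k)) / m + (1 - 1 / m) / 2 * D"
  \<comment> \<open>A deterministic lower bound for all schedules, hence for \<open>S_OPT x\<close>
    at almost every \<open>x\<close>.\<close>
  define L where "L = max D E"
  define B where "B = n * w_max * (2 / rate_min)"
  define V where "V = (\<Sum>j = 1..m. list_cost \<tau> w (2 / rate j) (S_CosMOS j))"
  define T where "T = (\<Sum>i = 1..n. \<tau> i)"
  have T: "T > 0" unfolding T_def using n pos by (intro sum_pos) auto
  have wmin_pos: "w_min > 0" using n pos by (simp add: wmin)
  \<comment> \<open>This puts \<open>w_min * T\<close> below \<open>L\<close>, so that
    \<open>B / L\<close> may be replaced by the fraction in the claim.\<close>
  have "w_min * T \<le> D"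
    unfolding T_def D_def sum_distrib_left wmin
    using pos by (intro sum_mono mult_right_mono) (auto intro: less_imp_le)
  then have wT: "0 < w_min * T" "w_min * T \<le> L"
    using T wmin_pos by (auto simp: L_def)
  then have L: "L > 0" by linarith
  have B: "B \<ge> 0"
  proof -
    have "w 1 \<le> w_max" using n by (simp add: wmax)
    then have "w_max > 0" using pos[of 1] n by simp
    moreover have "rate_min > 0" using m rate by (simp add: rmin)
    ultimately show ?thesis by (simp add: B_def)
  qed
  have V: "V \<le> (3 / 2 - 1 / (2 * m)) * (L + B)"
    unfolding V_def B_def wmax rmin
    using cosmos_cost_le[OF m n rate pos assms(10), of L] by (simp add: L_def E_def D_def)
  have times_nonneg: "AE x in M. \<forall>j\<in>{1..m}. 0 \<le> t j x \<and> 0 \<le> t' j x"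
    using exponential_nonneg_integrable(1)[OF rate t] exponential_nonneg_integrable(1)[OF rate t']
    by (intro AE_finite_allI) auto
  have AE_OPT: "AE x in M. L \<le> WCT_OPT x"
  proof -
    from AE_space times_nonneg show ?thesis
    proof eventually_elim
      case (elim x)
      have S: "valid_schedule m n (S_OPT x)"
        using assms(11) elim(1) by (auto simp: optimal_schedule_def is_arg_min_def)
      have "L \<le> (\<Sum>j = 1..m. list_cost \<tau> w 0 (S_OPT x j))"
        unfolding L_def E_def D_def
        using eastman_even_isaacs[OF m S pos ratio] valid_schedule_service_le[OF S pos] by simp
      also have "\<dots> \<le> WCT_OPT x"
        unfolding OPT WCT_eq_list_cost using elim(2) S pos
        by (intro sum_mono list_cost_mono) (force simp: valid_schedule_def intro: less_imp_le)+
      finally show ?case .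
    qed
  qed
  have COS_int: "integrable M WCT_CosMOS" and COS_exp: "(\<integral>x. WCT_CosMOS x \<partial>M) = V"
    using expected_WCT[OF rate t t', where S = S_CosMOS and m = m and \<tau> = \<tau> and w = w]
    unfolding COS V_def by (auto simp: has_bochner_integral_iff)
  have "set (S_CosMOS j) \<subseteq> {1..n}" for j
    using cosmos_run_greedy_plan[OF assms(10)[unfolded cosmos_schedule_def]] m
      greedy_plan_subset[of \<tau> _ _ "[1..<Suc n]" S_CosMOS j] by fastforce
  then have pos_COS: "0 < \<tau> i \<and> 0 < w i" if "i \<in> set (S_CosMOS j)" for i j
    using that pos by blast
  have COS_nonneg: "AE x in M. 0 \<le> WCT_CosMOS x"
    using times_nonneg
  proof eventually_elim
    case (elim x)
    then show ?case
      unfolding COS WCT_eq_list_cost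
      by (intro sum_nonneg list_cost_nonneg pos_COS) auto
  qed
  then have V0: "V \<ge> 0"
    using integral_nonneg_AE[OF COS_nonneg] COS_exp by simp
  have bound: "V / L \<le> \<alpha> * (1 + B / (w_min * T))" if "3 / 2 - 1 / (2 * m) \<le> \<alpha>" for \<alpha> :: real
  proof -
    have "1 / (2 * real m) \<le> 1" using m by simp
    then have \<alpha>: "\<alpha> \<ge> 0" using that by simp
    have "V \<le> \<alpha> * (L + B)"
      using V that L B by (meson add_nonneg_nonneg less_imp_le mult_right_mono order_trans)
    then have "V / L \<le> \<alpha> * (L + B) / L"
      using L by (simp add: divide_right_mono)
    also have "\<dots> = \<alpha> * (1 + B / L)" using L by (simp add: field_simps)
    also have "\<dots> \<le> \<alpha> * (1 + B / (w_min * T))"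
      using \<alpha> B wT L by (intro mult_left_mono add_left_mono divide_left_mono mult_pos_pos[OF L]) auto
    finally show ?thesis .
  qed
  have ratio_exp: "(\<integral>x. WCT_CosMOS x \<partial>M) / (\<integral>x. WCT_OPT x \<partial>M) \<le> V / L"
  proof (cases "integrable M WCT_OPT") \<comment> \<open>a non-integrable function has integral 0\<close>
    case True
    have "L \<le> (\<integral>x. WCT_OPT x \<partial>M)"
      using integral_mono_AE[OF integrable_const True AE_OPT] by (simp add: prob_space)
    then show ?thesis
      unfolding COS_exp using V0 L by (intro divide_left_mono mult_pos_pos) auto
  next
    case False
    then show ?thesis using V0 L by (simp add: not_integrable_integral_eq)
  qed
  \<comment> \<open>The random denominator is replaced almost everywhere by the constant
    \<open>L\<close>; what remains is an expectation of the CosMOS cost alone.\<close>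
  have exp_ratio: "(\<integral>x. WCT_CosMOS x / WCT_OPT x \<partial>M) \<le> V / L"
  proof (cases "integrable M (\<lambda>x. WCT_CosMOS x / WCT_OPT x)")
    case True
    have "(\<integral>x. WCT_CosMOS x / WCT_OPT x \<partial>M) \<le> (\<integral>x. WCT_CosMOS x / L \<partial>M)"
    proof (rule integral_mono_AE[OF True])
      show "integrable M (\<lambda>x. WCT_CosMOS x / L)" using COS_int by simp
      show "AE x in M. WCT_CosMOS x / WCT_OPT x \<le> WCT_CosMOS x / L"
        using AE_OPT COS_nonneg
        by eventually_elim (use L in \<open>auto intro!: divide_left_mono mult_pos_pos\<close>)
    qed
    then show ?thesis by (simp add: COS_exp)
  next
    case False
    then show ?thesis using V0 L by (simp add: not_integrable_integral_eq)
  qed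
  \<comment> \<open>The first value is at least \<open>3 / 2\<close>; the second exceeds the factor
    by \<open>(1 - 1 / m) / 2\<close>, which is nonnegative.\<close>
  have alpha: "3 / 2 - 1 / (2 * m) \<le> \<alpha>"
    if "\<alpha> = max (3 / 2) (w_max * rate_max / (w_min * rate_min)) \<or>
      (\<tau>_min > 2 / rate_max \<and> \<alpha> = 2 - 1 / real m)" for \<alpha>
  proof -
    have "1 / real m \<le> 1" "1 / real m \<ge> 0" using m by auto
    then have "3 / 2 - 1 / (2 * m) \<le> 3 / 2" "3 / 2 - 1 / (2 * m) \<le> 2 - 1 / real m"
      by (simp_all add: field_simps)
    then show ?thesis using that by (auto simp: le_max_iff_disj)
  qed
  show ?thesis
  proof (intro allI impI, drule alpha, drule bound, intro conjI)
    fix \<alpha> :: real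
    assume le: "V / L \<le> \<alpha> * (1 + B / (w_min * T))"
    show "(\<integral>x. WCT_CosMOS x \<partial>M) / (\<integral>x. WCT_OPT x \<partial>M)
        \<le> \<alpha> * (1 + real n * w_max * (2 / rate_min) / (w_min * (\<Sum>i = 1..n. \<tau> i)))"
      using ratio_exp le unfolding B_def T_def by (rule order_trans)
    show "(\<integral>x. WCT_CosMOS x / WCT_OPT x \<partial>M)
        \<le> \<alpha> * (1 + real n * w_max * (2 / rate_min) / (w_min * (\<Sum>i = 1..n. \<tau> i)))"
      using exp_ratio le unfolding B_def T_def by (rule order_trans)
  qed
qed

end
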